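(* Let $N\ge2$, let $\nu:\mathbb{R}^N\to\mathbb{R}$ be a function, and let $\mathcal{S}^N=\{\mathbf{w}\in\mathbb{R}_{\uparrow}^N\mid \mathbf{1}^\top\mathbf{w}=0\}$. The following statements are equivalent: (a) $\nu$ is a convex fairness measure; (b) there exists a nonempty convex compact set $\mathcal{W}_\nu\subseteq\mathcal{S}^N$ with $\mathcal{W}_\nu\ne\{\mathbf{0}\}$ such that $\nu(\mathbf{u})=\sup_{\mathbf{w}\in\mathcal{W}_\nu}\nu_{\mathbf{w}}(\mathbf{u})$ for all $\mathbf{u}\in\mathbb{R}^N$; (c) there exists a nonempty compact set $\mathcal{W}_\nu\subseteq\mathcal{S}^N$ with $\mathcal{W}_\nu\ne\{\mathbf{0}\}$ such that $\nu(\mathbf{u})=\sup_{\mathbf{w}\in\mathcal{W}_\nu}\nu_{\mathbf{w}}(\mathbf{u})$ for all $\mathbf{u}\in\mathbb{R}^N$.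
   Context: For $\mathbf{u}\in\mathbb{R}^N$, $u_{(i)}$ denotes the $i$th smallest entry of $\mathbf{u}$; $\mathbf{1}$ and $\mathbf{0}$ are the all-ones and zero vectors; $\mathbb{R}_{\uparrow}^N=\{\mathbf{x}\in\mathbb{R}^N\mid x_1\le\dots\le x_N\}$. For $\mathbf{w}\in\mathbb{R}^N$, $\nu_{\mathbf{w}}(\mathbf{u})=\sum_{i=1}^N w_iu_{(i)}$. A function $\phi:\mathbb{R}^N\to\mathbb{R}$ is a convex fairness measure if it satisfies: - Continuity: $\phi$ is continuous on $\mathbb{R}^N$. - Normalization: $\phi(\mathbf{u})\ge0$ for all $\mathbf{u}\in\mathbb{R}^N$, and $\phi(\mathbf{u})=0$ if and only if $\mathbf{u}=\alpha\mathbf{1}$ for some $\alpha\in\mathbb{R}$. - Symmetry: $\phi(P\mathbf{u})=\phi(\mathbf{u})$ for all $\mathbf{u}$ and all permutation matrices $P$. - Translation Invariance: $\phi(\mathbf{u}+\alpha\mathbf{1})=\phi(\mathbf{u})$ for all $\mathbf{u}$ and $\alpha\in\mathbb{R}$. - Positive Homogeneity: $\phi(\alpha\mathbf{u})=\alpha\phi(\mathbf{u})$ for all $\mathbf{u}$ and $\alpha>0$. - Convexity: $\phi(\alpha\mathbf{u}^1+(1-\alpha)\mathbf{u}^2)\le\alpha\phi(\mathbf{u}^1)+(1-\alpha)\phi(\mathbf{u}^2)$ for all $\mathbf{u}^1,\mathbf{u}^2\in\mathbb{R}^N$ and $\alpha\in(0,1)$. *)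

theory Defs
  imports "HOL-Analysis.Analysis"
begin

text \<open>
  A vector with N entries is an element of \<open>real ^ 'n\<close> for a finite linearly ordered index type
  \<open>'n\<close> with \<open>CARD('n) = N\<close>; the order on \<open>'n\<close> plays the role of the order on 1, ..., N,
  the k-th index being the one with exactly \<open>k - 1\<close> predecessors.
\<close>

text \<open>
  \<open>order_stat u $ i\<close> is the i-th smallest entry of \<open>u\<close>, counted with multiplicity. List positions
  start at 0, so the k-th index selects position \<open>card {..<i} = k - 1\<close>.
\<close>

definition order_stat :: "real ^ 'n::{finite,linorder} \<Rightarrow> real ^ 'n::{finite,linorder}" where
  "order_stat u = (\<chi> i. sort (map (\<lambda>j. u $ j) (sorted_list_of_set UNIV)) ! card {..<i})"

definition weighted_order_sum ::
    "real ^ 'n::{finite,linorder} \<Rightarrow> real ^ 'n::{finite,linorder} \<Rightarrow> real" where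
  "weighted_order_sum w u = (\<Sum>i\<in>UNIV. w $ i * order_stat u $ i)"

definition ascending_vectors :: "(real ^ 'n::{finite,linorder}) set" where
  "ascending_vectors = {x. \<forall>i j. i \<le> j \<longrightarrow> x $ i \<le> x $ j}"

text \<open>In \<open>real ^ 'n\<close> the constant \<open>1\<close> is the all-ones vector.\<close>

definition ascending_zero_sum :: "(real ^ 'n::{finite,linorder}) set" where
  "ascending_zero_sum = {w \<in> ascending_vectors. 1 \<bullet> w = 0}"

definition permutation_matrix :: "real ^ 'n ^ 'n \<Rightarrow> bool" where
  "permutation_matrix P \<longleftrightarrow>
     (\<exists>p. p permutes UNIV \<and> P = (\<chi> i j. if j = p i then 1 else 0))"

definition convex_fairness_measure :: "(real ^ 'n \<Rightarrow> real) \<Rightarrow> bool" where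
  "convex_fairness_measure \<phi> \<longleftrightarrow>
     continuous_on UNIV \<phi> \<and>
     (\<forall>u. \<phi> u \<ge> 0) \<and>
     (\<forall>u. \<phi> u = 0 \<longleftrightarrow> (\<exists>\<alpha>. u = \<alpha> *\<^sub>R 1)) \<and>
     (\<forall>u P. permutation_matrix P \<longrightarrow> \<phi> (P *v u) = \<phi> u) \<and>
     (\<forall>u \<alpha>. \<phi> (u + \<alpha> *\<^sub>R 1) = \<phi> u) \<and>
     (\<forall>u \<alpha>. \<alpha> > 0 \<longrightarrow> \<phi> (\<alpha> *\<^sub>R u) = \<alpha> * \<phi> u) \<and>
     (\<forall>u v \<alpha>. 0 < \<alpha> \<and> \<alpha> < 1 \<longrightarrow>
        \<phi> (\<alpha> *\<^sub>R u + (1 - \<alpha>) *\<^sub>R v) \<le> \<alpha> * \<phi> u + (1 - \<alpha>) * \<phi> v)"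

end

theory Submission
  imports Defs
begin

text \<open>
  By the rearrangement inequality, for ascending \<open>w\<close> the value \<open>weighted_order_sum w u\<close> is the
  maximum of the linear forms \<open>\<Sum>i. w $ i * u $ p i\<close> over all permutations \<open>p\<close>. A supremum over a
  compact set of weights is thus an attained maximum of linear forms, and all properties of a
  fairness measure can be read off from that; strict positivity off the constants comes from
  \<open>2 N (\<Sum>i. w\<^sub>i x\<^sub>i) = (\<Sum>i j. (w\<^sub>i - w\<^sub>j) (x\<^sub>i - x\<^sub>j))\<close> for \<open>w\<close> of sum zero.

  Conversely, a convex fairness measure is sublinear, so it is the pointwise maximum of the linear
  forms below it. The set of these forms is compact, convex and, by symmetry, closed under
  permutation of the entries; sorting a form can only increase its pairing with a sorted vector, so
  the ascending members suffice.
\<close>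

section \<open>The rearrangement inequality\<close>

text \<open>Induction on the largest element \<open>m\<close>: an exchange that pairs
  \<open>f m\<close> with \<open>g m\<close> does not decrease the sum, and leaves a permutation of
  the remaining indices.\<close>

lemma rearrangement:
  fixes f g :: "'a::linorder \<Rightarrow> 'b::linordered_idom"
  assumes "finite S" and "mono_on S f" and "mono_on S g" and "p permutes S"
  shows "(\<Sum>i\<in>S. f i * g (p i)) \<le> (\<Sum>i\<in>S. f i * g i)"
  using assms
proof (induction S arbitrary: p rule: finite_linorder_max_induct)
  case empty
  then show ?case by simp
next
  case (insert m S)
  have mS: "m \<notin> S" using insert.hyps by blast
  \<comment> \<open>Swapping the values \<open>m\<close> and \<open>p m\<close> makes
    \<open>q\<close> fix \<open>m\<close>, so that \<open>q\<close> permutes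
    \<open>S\<close>.\<close>
  define q where "q = Transposition.transpose m (p m) \<circ> p"
  have q: "q permutes S"
    unfolding q_def using insert.prems(3) by (rule permutes_insert_lemma)
  have IH: "(\<Sum>i\<in>S. f i * g (q i)) \<le> (\<Sum>i\<in>S. f i * g i)"
    using insert.IH insert.prems q by (meson mono_on_subset subset_insertI)
  have "(\<Sum>i\<in>insert m S. f i * g (p i)) \<le> f m * g m + (\<Sum>i\<in>S. f i * g (q i))"
  proof (cases "p m = m")
    case True
    then show ?thesis using insert.hyps mS by (simp add: q_def)
  next
    case False
    obtain k where k: "p k = m"
      using insert.prems(3) by (metis permutes_inverses(1))
    have inj: "inj p" using insert.prems(3) by (rule permutes_inj)
    have kS: "k \<in> S"
      using k False insert.prems(3) by (metis insertE insertI1 permutes_in_image)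
    have pmS: "p m \<in> S"
      using False insert.prems(3) by (metis insertE insertI1 permutes_in_image)
    have qk: "q k = p m" by (simp add: q_def k)
    have rest: "(\<Sum>i\<in>S - {k}. f i * g (q i)) = (\<Sum>i\<in>S - {k}. f i * g (p i))"
    proof (rule sum.cong)
      fix i assume i: "i \<in> S - {k}"
      then have "p i \<noteq> m" "p i \<noteq> p m" using k mS inj by (auto dest: injD)
      then show "f i * g (q i) = f i * g (p i)" by (simp add: q_def)
    qed simp
    have "f k \<le> f m" "g (p m) \<le> g m"
      using insert.hyps insert.prems kS pmS by (auto simp: mono_on_def intro: less_imp_le)
    \<comment> \<open>Besides \<open>m\<close>, the two permutations differ only at the preimage
      \<open>k\<close> of \<open>m\<close>; this product is exactly the gain of the
      exchange.\<close>
    then have "0 \<le> (f m - f k) * (g m - g (p m))" by simp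
    then have "f m * g (p m) + f k * g m \<le> f m * g m + f k * g (p m)"
      by (simp add: algebra_simps)
    then show ?thesis
      using insert.hyps mS kS by (simp add: sum.remove[of S k] rest k qk)
  qed
  with IH show ?case using insert.hyps mS by simp
qed

section \<open>Sorted vectors and permutations of the entries\<close>

text \<open>Passes between indices and list positions: the number of predecessors is strictly
  increasing, hence injective, and counting gives surjectivity.\<close>

lemma bij_betw_card_lessThan:
  "bij_betw (\<lambda>i::'n::{finite,linorder}. card {..<i}) UNIV {..<CARD('n)}"
proof -
  have less: "card {..<i} < card {..<j}" if "i < j" for i j :: 'n
    using that by (intro psubset_card_mono) (auto simp: psubset_eq)
  have "inj (\<lambda>i::'n. card {..<i})"
    by (rule injI) (metis less less_irrefl linorder_less_linear)
  moreover have "(\<lambda>i::'n. card {..<i}) ` UNIV \<subseteq> {..<CARD('n)}"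
    by (auto intro!: psubset_card_mono)
  ultimately show ?thesis
    unfolding bij_betw_def by (simp add: card_image card_subset_eq)
qed

lemma order_stat_ascending: "order_stat u \<in> ascending_vectors"
  for u :: "real ^ 'n::{finite,linorder}"
proof -
  have "order_stat u $ i \<le> order_stat u $ j" if "i \<le> j" for i j :: 'n
  proof -
    have "card {..<j} < CARD('n)"
      using bij_betw_card_lessThan bij_betwE by blast
    moreover have "card {..<i} \<le> card {..<j}"
      using that by (intro card_mono) auto
    ultimately show ?thesis
      unfolding order_stat_def by (simp add: sorted_nth_mono)
  qed
  then show ?thesis by (simp add: ascending_vectors_def)
qed

text \<open>The witness chains three bijections: index to rank, rank to the position in the unsorted
  list that supplies the entry, position to index.\<close>

lemma order_stat_permutation:
  fixes u :: "real ^ 'n::{finite,linorder}"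
  obtains p where "p permutes UNIV" and "order_stat u = (\<chi> i. u $ p i)"
proof -
  define L :: "'n list" where "L = sorted_list_of_set UNIV"
  have L: "distinct L" "set L = UNIV" "length L = CARD('n)"
    by (simp_all add: L_def)
  let ?xs = "map (\<lambda>j. u $ j) L"
  obtain q where q: "q permutes {..<length ?xs}" "permute_list q ?xs = sort ?xs"
    using mset_eq_permutation[of "sort ?xs" ?xs] by auto
  have q': "bij_betw q {..<CARD('n)} {..<CARD('n)}"
    using permutes_imp_bij[OF q(1)] L by simp
  let ?r = "\<lambda>i::'n. card {..<i}"
  define p where "p = (!) L \<circ> (q \<circ> ?r)"
  have "bij_betw ((!) L) {..<CARD('n)} UNIV"
    using L by (intro bij_betw_nth) auto
  then have "bij p"
    unfolding p_def
    by (intro bij_betw_trans[OF bij_betw_trans[OF bij_betw_card_lessThan q']])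
  then have "p permutes UNIV" by (intro bij_imp_permutes) auto
  moreover have "order_stat u $ i = u $ p i" for i
  proof -
    have r: "?r i < CARD('n)" using bij_betw_card_lessThan bij_betwE by blast
    then have "q (?r i) < CARD('n)" using q' bij_betwE by fastforce
    moreover have "order_stat u $ i = permute_list q ?xs ! ?r i"
      unfolding order_stat_def q(2) by (simp add: L_def)
    ultimately show ?thesis
      using r q(1) L by (simp add: permute_list_nth p_def)
  qed
  ultimately show thesis
    using that by (simp add: vec_eq_iff)
qed

lemma weighted_order_sum_inner: "weighted_order_sum w u = w \<bullet> order_stat u"
  by (simp add: weighted_order_sum_def inner_vec_def)

lemma inner_permuted_le:
  fixes w x :: "real ^ 'n::{finite,linorder}"
  assumes "w \<in> ascending_vectors" "x \<in> ascending_vectors" "p permutes UNIV"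
  shows "w \<bullet> (\<chi> i. x $ p i) \<le> w \<bullet> x"
  using rearrangement[of UNIV "\<lambda>i. w $ i" "\<lambda>i. x $ i" p] assms
  by (simp add: ascending_vectors_def inner_vec_def mono_on_def)

lemma inner_permuted_inv:
  fixes w u :: "real ^ 'n"
  assumes "p permutes UNIV"
  shows "w \<bullet> (\<chi> i. u $ p i) = (\<chi> i. w $ inv p i) \<bullet> u"
  using sum.permute[OF assms, of "\<lambda>i. w $ inv p i * u $ i"] permutes_inverses(2)[OF assms]
  by (simp add: inner_vec_def)

text \<open>A rearrangement of \<open>u\<close> is also a rearrangement of the sorted
  \<open>u\<close>, through the inverse of the sorting permutation, so the inequality for two
  ascending vectors applies.\<close>

lemma inner_permuted_le_weighted_order_sum:
  fixes w u :: "real ^ 'n::{finite,linorder}"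
  assumes w: "w \<in> ascending_vectors" and p: "p permutes UNIV"
  shows "w \<bullet> (\<chi> i. u $ p i) \<le> weighted_order_sum w u"
proof -
  obtain s where s: "s permutes UNIV" "order_stat u = (\<chi> i. u $ s i)"
    using order_stat_permutation by blast
  have "u $ p i = order_stat u $ (inv s \<circ> p) i" for i
    using s by (simp add: permutes_inverses)
  then have "(\<chi> i. u $ p i) = (\<chi> i. order_stat u $ (inv s \<circ> p) i)"
    by (simp add: vec_eq_iff)
  moreover have "inv s \<circ> p permutes UNIV"
    using p s(1) by (intro permutes_compose permutes_inv)
  ultimately show ?thesis
    using inner_permuted_le[OF w order_stat_ascending, of "inv s \<circ> p" u]
    by (simp add: weighted_order_sum_inner)
qed

text \<open>The permutation that sorts \<open>w\<close> can be moved onto \<open>u\<close> without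
  changing the inner product, which reduces the claim to an ascending weight.\<close>

lemma inner_le_order_stat:
  fixes w u :: "real ^ 'n::{finite,linorder}"
  shows "w \<bullet> u \<le> order_stat w \<bullet> order_stat u"
proof -
  obtain s where s: "s permutes UNIV" "order_stat w = (\<chi> i. w $ s i)"
    using order_stat_permutation by blast
  have "w \<bullet> u = order_stat w \<bullet> (\<chi> i. u $ s i)"
    using s by (simp add: inner_permuted_inv permutes_inverses)
  also have "\<dots> \<le> order_stat w \<bullet> order_stat u"
    using inner_permuted_le_weighted_order_sum[OF order_stat_ascending s(1)]
    by (simp add: weighted_order_sum_inner)
  finally show ?thesis .
qed

section \<open>Positivity of ascending weights of sum zero\<close>

text \<open>After expansion the mixed terms factor through the sum of the entries of
  \<open>w\<close> and vanish; the two diagonal terms each contribute \<open>CARD('n)\<close> copies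
  of \<open>w \<bullet> x\<close>.\<close>

lemma zero_sum_inner_double_sum:
  fixes w x :: "real ^ 'n"
  assumes "1 \<bullet> w = 0"
  shows "(\<Sum>i\<in>(UNIV :: 'n set). \<Sum>j\<in>(UNIV :: 'n set). (w $ i - w $ j) * (x $ i - x $ j)) = 2 * CARD('n) * (w \<bullet> x)"
proof -
  have w: "(\<Sum>i\<in>(UNIV :: 'n set). w $ i) = 0" using assms by (simp add: inner_vec_def)
  have cross: "(\<Sum>i\<in>(UNIV :: 'n set). \<Sum>j\<in>(UNIV :: 'n set). w $ i * x $ j) = 0"
    by (simp add: w flip: sum_distrib_left sum_distrib_right)
  then have cross': "(\<Sum>i\<in>(UNIV :: 'n set). \<Sum>j\<in>(UNIV :: 'n set). w $ j * x $ i) = 0"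
    by (subst sum.swap)
  have "(\<Sum>i\<in>(UNIV :: 'n set). \<Sum>j\<in>(UNIV :: 'n set). (w $ i - w $ j) * (x $ i - x $ j)) =
    (\<Sum>i\<in>(UNIV :: 'n set). \<Sum>j\<in>(UNIV :: 'n set). w $ i * x $ i) + (\<Sum>i\<in>(UNIV :: 'n set). \<Sum>j\<in>(UNIV :: 'n set). w $ j * x $ j)
    - (\<Sum>i\<in>(UNIV :: 'n set). \<Sum>j\<in>(UNIV :: 'n set). w $ i * x $ j) - (\<Sum>i\<in>(UNIV :: 'n set). \<Sum>j\<in>(UNIV :: 'n set). w $ j * x $ i)"
    by (simp add: algebra_simps sum.distrib sum_subtractf)
  then show ?thesis
    by (simp only: cross cross') (simp add: inner_vec_def flip: sum_distrib_left)
qed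

text \<open>Differences of two ascending vectors never have opposite signs, so all terms of the
  double sum are nonnegative, and all vanish if the total does. The term of the extreme indices then
  decides.\<close>

lemma ascending_zero_sum_inner:
  fixes w x :: "real ^ 'n::{finite,linorder}"
  assumes w: "w \<in> ascending_zero_sum" and x: "x \<in> ascending_vectors"
  shows "0 \<le> w \<bullet> x" and "w \<bullet> x = 0 \<Longrightarrow> w \<noteq> 0 \<Longrightarrow> x $ i = x $ j"
proof -
  let ?t = "\<lambda>i j. (w $ i - w $ j) * (x $ i - x $ j)"
  have ds: "(\<Sum>i\<in>UNIV. \<Sum>j\<in>UNIV. ?t i j) = 2 * CARD('n) * (w \<bullet> x)"
    using w by (intro zero_sum_inner_double_sum) (simp add: ascending_zero_sum_def)
  have wm: "w $ i \<le> w $ j" and xm: "x $ i \<le> x $ j" if "i \<le> j" for i j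
    using that w x by (auto simp: ascending_zero_sum_def ascending_vectors_def)
  have t: "0 \<le> ?t i j" for i j
    by (cases "i \<le> j") (auto simp: wm xm mult_nonneg_nonneg mult_nonpos_nonpos)
  have "0 \<le> (\<Sum>i\<in>UNIV. \<Sum>j\<in>UNIV. ?t i j)"
    by (intro sum_nonneg t)
  then show "0 \<le> w \<bullet> x" by (simp add: ds zero_le_mult_iff)
  assume "w \<bullet> x = 0" "w \<noteq> 0"
  then have "(\<Sum>i\<in>UNIV. \<Sum>j\<in>UNIV. ?t i j) = 0" by (simp add: ds)
  then have t0: "?t i j = 0" for i j
    using t by (simp add: sum_nonneg_eq_0_iff sum_nonneg)
  define a b :: 'n where "a = Min UNIV" and "b = Max UNIV"
  have ab: "a \<le> i" "i \<le> b" for i by (simp_all add: a_def b_def)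
  \<comment> \<open>Equal extreme entries would make the ascending \<open>w\<close> constant, and a
    constant vector of sum zero is zero.\<close>
  have "w $ a \<noteq> w $ b"
  proof
    assume eq: "w $ a = w $ b"
    have const: "w $ i = w $ a" for i
      using wm[OF ab(1)[of i]] wm[OF ab(2)[of i]] eq by simp
    have "(\<Sum>i\<in>UNIV. w $ i) = 0"
      using w by (simp add: ascending_zero_sum_def inner_vec_def)
    moreover have "(\<Sum>i\<in>UNIV. w $ i) = (\<Sum>i\<in>(UNIV :: 'n set). w $ a)"
      by (rule sum.cong[OF refl const])
    ultimately have "w $ a = 0" by simp
    then show False using const \<open>w \<noteq> 0\<close> by (metis vec_eq_iff zero_index)
  qed
  then have "x $ a = x $ b" using t0[of a b] by simp
  then show "x $ i = x $ j"
    using xm[OF ab(1)] xm[OF ab(2)] by (metis order_antisym)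
qed

lemma permutation_matrix_vector_mult:
  fixes u :: "real ^ 'n"
  shows "(\<chi> i j. if j = p i then 1 else 0) *v u = (\<chi> i. u $ p i)"
  by (simp add: vec_eq_iff matrix_vector_mult_def if_distrib[of "\<lambda>x. x * _"] cong: if_cong)

section \<open>Linear minorants of sublinear functions\<close>

text \<open>A hyperplane supporting the epigraph at \<open>(x, f x)\<close> yields an affine
  minorant touching \<open>f\<close> at \<open>x\<close>; homogeneity removes its constant
  term.\<close>

lemma sublinear_linear_minorant:
  fixes f :: "'a::euclidean_space \<Rightarrow> real"
  assumes conv: "convex_on UNIV f"
    and hom: "\<And>u t. t > 0 \<Longrightarrow> f (t *\<^sub>R u) = t * f u"
  obtains w where "\<And>u. w \<bullet> u \<le> f u" and "w \<bullet> x = f x"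
proof -
  have f0: "f 0 = 0" using hom[of 2 0] by simp
  \<comment> \<open>The strict epigraph leaves out \<open>(x, f x)\<close>, so it can be separated
    from that point.\<close>
  define S where "S = {z. f (fst z) < snd z}"
  have "convex S"
  proof (rule convexI)
    fix y z and s t :: real
    assume yz: "y \<in> S" "z \<in> S" and st: "0 \<le> s" "0 \<le> t" "s + t = 1"
    have "f (s *\<^sub>R fst y + t *\<^sub>R fst z) \<le> s * f (fst y) + t * f (fst z)"
      using conv st by (simp add: convex_on_def)
    also have "\<dots> < s * snd y + t * snd z"
    proof (cases "s = 0")
      case True
      then show ?thesis using st yz by (simp add: S_def)
    next
      case False
      then have "s * f (fst y) < s * snd y" using st yz by (simp add: S_def)
      moreover have "t * f (fst z) \<le> t * snd z"
        using st yz by (intro mult_left_mono) (simp_all add: S_def)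
      ultimately show ?thesis by simp
    qed
    finally show "s *\<^sub>R y + t *\<^sub>R z \<in> S" by (simp add: S_def)
  qed
  moreover have "(0, 1) \<in> S" by (simp add: S_def f0)
  moreover have "S \<inter> {(x, f x)} = {}" by (simp add: S_def)
  ultimately have "\<exists>z \<beta>. z \<noteq> 0 \<and> (\<forall>y\<in>S. z \<bullet> y \<le> \<beta>) \<and> (\<forall>y\<in>{(x, f x)}. z \<bullet> y \<ge> \<beta>)"
    by (intro separating_hyperplane_sets) auto
  then obtain z \<beta> where "z \<noteq> 0" and zS: "\<forall>y\<in>S. z \<bullet> y \<le> \<beta>"
    and zx: "z \<bullet> (x, f x) \<ge> \<beta>"
    by blast
  obtain v c where z: "z = (v, c)" by fastforce
  have le: "v \<bullet> u + c * t \<le> v \<bullet> x + c * f x" if "f u < t" for u t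
    using bspec[OF zS, of "(u, t)"] that zx by (simp add: S_def z)
  have "c \<le> 0" using le[of x "f x + 1"] by (simp add: algebra_simps)
  moreover have "c \<noteq> 0"
  proof
    assume "c = 0"
    \<comment> \<open>A vertical hyperplane would bound the form of \<open>v\<close> on the whole
      space; a move from \<open>x\<close> in direction \<open>v\<close> refutes this unless
      \<open>v = 0\<close>.\<close>
    then have "v \<bullet> (x + v) \<le> v \<bullet> x" using le[of "x + v" "f (x + v) + 1"] by simp
    then have "v = 0" by (simp add: inner_add_right flip: power2_norm_eq_inner)
    then show False using \<open>z \<noteq> 0\<close> \<open>c = 0\<close> by (simp add: z zero_prod_def)
  qed
  ultimately have c: "c < 0" by simp
  define w where "w = (- 1 / c) *\<^sub>R v"
  have wv: "v \<bullet> u = - c * (w \<bullet> u)" for u using c by (simp add: w_def)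
  have sub: "w \<bullet> u - f u \<le> w \<bullet> x - f x" for u
  \<comment> \<open>Points of the graph lie outside \<open>S\<close> and are approached from
    above.\<close>
  proof (rule field_le_epsilon)
    fix e :: real assume "0 < e"
    then have "- c * (w \<bullet> u - (f u + e)) \<le> - c * (w \<bullet> x - f x)"
      using le[of u "f u + e"] by (simp add: wv algebra_simps)
    then show "w \<bullet> u - f u \<le> w \<bullet> x - f x + e" using c by (simp add: mult_le_cancel_left)
  qed
  \<comment> \<open>With \<open>g = w \<bullet> x - f x\<close>, the points \<open>0\<close> and
    \<open>2 *\<^sub>R x\<close> give \<open>0 \<le> g\<close> and
    \<open>2 * g \<le> g\<close>.\<close>
  have "w \<bullet> x = f x"
    using sub[of 0] sub[of "2 *\<^sub>R x"] by (simp add: f0 hom)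
  moreover from this have "w \<bullet> u \<le> f u" for u using sub[of u] by simp
  ultimately show thesis using that by blast
qed

lemma convex_linear_minorants: "convex {w. \<forall>u. w \<bullet> u \<le> f u}"
proof -
  have "{w. \<forall>u. w \<bullet> u \<le> f u} = (\<Inter>u. {w. u \<bullet> w \<le> f u})"
    by (auto simp: inner_commute)
  then show ?thesis by (auto intro: convex_INT convex_halfspace_le)
qed

text \<open>An intersection of closed half-spaces, bounded because the values of \<open>f\<close> at
  a basis vector and at its negative confine each coordinate.\<close>

lemma compact_linear_minorants:
  fixes f :: "'a::euclidean_space \<Rightarrow> real"
  shows "compact {w. \<forall>u. w \<bullet> u \<le> f u}"
proof -
  let ?D = "{w. \<forall>u. w \<bullet> u \<le> f u}"
  have "?D = (\<Inter>u. {w. u \<bullet> w \<le> f u})"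
    by (auto simp: inner_commute)
  then have "closed ?D" by (auto intro: closed_INT closed_halfspace_le)
  moreover have "norm w \<le> (\<Sum>b\<in>Basis. \<bar>f b\<bar> + \<bar>f (- b)\<bar>)" if "w \<in> ?D" for w
  proof -
    have "norm w \<le> (\<Sum>b\<in>Basis. \<bar>w \<bullet> b\<bar>)" by (rule norm_le_l1)
    also have "\<dots> \<le> (\<Sum>b\<in>Basis. \<bar>f b\<bar> + \<bar>f (- b)\<bar>)"
    proof (rule sum_mono)
      fix b :: 'a
      have "w \<bullet> b \<le> f b" "w \<bullet> (- b) \<le> f (- b)" using that by blast+
      then show "\<bar>w \<bullet> b\<bar> \<le> \<bar>f b\<bar> + \<bar>f (- b)\<bar>" by simp
    qed
    finally show ?thesis .
  qed
  then have "bounded ?D" by (auto simp: bounded_iff)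
  ultimately show ?thesis by (simp add: compact_eq_bounded_closed)
qed

lemma convex_ascending_vectors: "convex ascending_vectors"
  by (auto simp: convex_def ascending_vectors_def intro!: add_mono mult_left_mono)

lemma closed_ascending_vectors: "closed (ascending_vectors :: (real ^ 'n::{finite,linorder}) set)"
proof -
  have eq: "ascending_vectors = (\<Inter>i. \<Inter>j\<in>{i..}. {x :: real ^ 'n::{finite,linorder}. x $ i \<le> x $ j})"
    by (auto simp: ascending_vectors_def)
  show ?thesis
    unfolding eq by (intro closed_INT ballI closed_Collect_le continuous_intros)
qed

lemma order_stat_const_iff:
  fixes u :: "real ^ 'n::{finite,linorder}"
  shows "(\<forall>i j. order_stat u $ i = order_stat u $ j) \<longleftrightarrow> (\<exists>\<alpha>. u = \<alpha> *\<^sub>R 1)"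
proof -
  obtain p where p: "p permutes UNIV" and u: "order_stat u = (\<chi> i. u $ p i)"
    using order_stat_permutation by blast
  show ?thesis
  proof
    assume "\<forall>i j. order_stat u $ i = order_stat u $ j"
    then have eq: "u $ p i = u $ p j" for i j by (simp add: u)
    have "u $ i = u $ j" for i j
      using eq[of "inv p i" "inv p j"] p by (simp add: permutes_inverses)
    then have "u = (u $ undefined) *\<^sub>R 1" by (simp add: vec_eq_iff)
    then show "\<exists>\<alpha>. u = \<alpha> *\<^sub>R 1" by blast
  qed (auto simp: u)
qed

section \<open>From a compact set of weights to a fairness measure\<close>

text \<open>Most properties reduce to one inequality: some weight and permutation attain the value
  on the left, and the same pair bounds the right-hand side from below.\<close>

lemma convex_fairness_measure_SUP:
  fixes \<nu> :: "real ^ 'n::{finite,linorder} \<Rightarrow> real"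
  assumes W: "W \<noteq> {}" "compact W" "W \<subseteq> ascending_zero_sum" "W \<noteq> {0}"
    and \<nu>: "\<And>u. \<nu> u = (SUP w\<in>W. weighted_order_sum w u)"
  shows "convex_fairness_measure \<nu>"
proof -
  \<comment> \<open>Compactness turns the \<open>SUP\<close> into an attained maximum.\<close>
  have max: "\<exists>w\<in>W. \<nu> u = w \<bullet> order_stat u \<and> (\<forall>v\<in>W. v \<bullet> order_stat u \<le> \<nu> u)" for u
  proof -
    have "continuous_on W (\<lambda>v. v \<bullet> order_stat u)" by (intro continuous_intros)
    then obtain w where w: "w \<in> W" "\<forall>v\<in>W. v \<bullet> order_stat u \<le> w \<bullet> order_stat u"
      using continuous_attains_sup[OF W(2,1)] by blast
    then have "\<nu> u = w \<bullet> order_stat u"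
      unfolding \<nu> weighted_order_sum_inner by (intro cSup_eq_maximum) auto
    then show ?thesis using w by auto
  qed
  have asc: "w \<in> ascending_vectors" "1 \<bullet> w = 0" if "w \<in> W" for w
    using that W(3) by (auto simp: ascending_zero_sum_def)
  have le: "w \<bullet> (\<chi> i. u $ p i) \<le> \<nu> u" if "w \<in> W" "p permutes UNIV" for w u p
    using inner_permuted_le_weighted_order_sum[OF asc(1)[OF that(1)] that(2), of u] max[of u] that(1)
    by (auto simp: weighted_order_sum_inner intro: order_trans)
  have attained: "\<exists>w\<in>W. \<exists>p. p permutes UNIV \<and> \<nu> u = w \<bullet> (\<chi> i. u $ p i)" for u
    using max[of u] order_stat_permutation[of u] by metis
  \<comment> \<open>Here and in \<open>scale_le\<close> and \<open>permute_le\<close> one direction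
    suffices; equality follows later by applying it to the inverse operation.\<close>
  have translation_le: "\<nu> (u + \<alpha> *\<^sub>R 1) \<le> \<nu> u" for u \<alpha>
  proof -
    obtain w p where wp: "w \<in> W" "p permutes UNIV"
      "\<nu> (u + \<alpha> *\<^sub>R 1) = w \<bullet> (\<chi> i. (u + \<alpha> *\<^sub>R 1) $ p i)"
      using attained by blast
    have "(\<chi> i. (u + \<alpha> *\<^sub>R 1) $ p i) = (\<chi> i. u $ p i) + \<alpha> *\<^sub>R 1"
      by (simp add: vec_eq_iff)
    then show ?thesis
      using wp le[OF wp(1,2), of u] asc(2)[OF wp(1)]
      by (simp add: inner_add_right inner_commute[of w 1])
  qed
  have scale_le: "\<nu> (\<alpha> *\<^sub>R u) \<le> \<alpha> * \<nu> u" if "\<alpha> > 0" for u \<alpha>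
  proof -
    obtain w p where wp: "w \<in> W" "p permutes UNIV"
      "\<nu> (\<alpha> *\<^sub>R u) = w \<bullet> (\<chi> i. (\<alpha> *\<^sub>R u) $ p i)"
      using attained by blast
    have "(\<chi> i. (\<alpha> *\<^sub>R u) $ p i) = \<alpha> *\<^sub>R (\<chi> i. u $ p i)"
      by (simp add: vec_eq_iff)
    then show ?thesis
      using wp le[OF wp(1,2), of u] that by simp
  qed
  have permute_le: "\<nu> (\<chi> i. u $ p i) \<le> \<nu> u" if p: "p permutes UNIV" for u p
  proof -
    obtain w q where wq: "w \<in> W" "q permutes UNIV"
      "\<nu> (\<chi> i. u $ p i) = w \<bullet> (\<chi> i. (\<chi> i. u $ p i) $ q i)"
      using attained by blast
    then show ?thesis
      using le[OF wq(1) permutes_compose[OF wq(2) p], of u] by simp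
  qed
  have convex: "\<nu> (\<alpha> *\<^sub>R u + (1 - \<alpha>) *\<^sub>R v) \<le> \<alpha> * \<nu> u + (1 - \<alpha>) * \<nu> v"
    if "0 < \<alpha>" "\<alpha> < 1" for u v \<alpha>
  proof -
    obtain w p where wp: "w \<in> W" "p permutes UNIV"
      "\<nu> (\<alpha> *\<^sub>R u + (1 - \<alpha>) *\<^sub>R v) = w \<bullet> (\<chi> i. (\<alpha> *\<^sub>R u + (1 - \<alpha>) *\<^sub>R v) $ p i)"
      using attained by blast
    have "(\<chi> i. (\<alpha> *\<^sub>R u + (1 - \<alpha>) *\<^sub>R v) $ p i) =
        \<alpha> *\<^sub>R (\<chi> i. u $ p i) + (1 - \<alpha>) *\<^sub>R (\<chi> i. v $ p i)"
      by (simp add: vec_eq_iff)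
    then have "\<nu> (\<alpha> *\<^sub>R u + (1 - \<alpha>) *\<^sub>R v) =
        \<alpha> * (w \<bullet> (\<chi> i. u $ p i)) + (1 - \<alpha>) * (w \<bullet> (\<chi> i. v $ p i))"
      by (simp only: wp(3) inner_add_right inner_scaleR_right)
    also have "\<dots> \<le> \<alpha> * \<nu> u + (1 - \<alpha>) * \<nu> v"
      using that by (intro add_mono mult_left_mono le wp(1,2)) auto
    finally show ?thesis .
  qed
  have nonneg: "0 \<le> \<nu> u" for u
    using max[of u] W(3) ascending_zero_sum_inner(1)[OF _ order_stat_ascending] by fastforce
  have zero_iff: "\<nu> u = 0 \<longleftrightarrow> (\<exists>\<alpha>. u = \<alpha> *\<^sub>R 1)" for u
  proof
    assume "\<nu> u = 0"
    \<comment> \<open>A nonzero weight exists as \<open>W\<close> is neither empty nor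
      \<open>{0}\<close>; its pairing with the sorted \<open>u\<close> lies between 0 and
      \<open>\<nu> u\<close>.\<close>
    obtain w where w: "w \<in> W" "w \<noteq> 0" using W(1,4) by auto
    then have "w \<in> ascending_zero_sum" using W(3) by blast
    note pos = ascending_zero_sum_inner[OF this order_stat_ascending, of u]
    have "w \<bullet> order_stat u = 0"
      using max[of u] w(1) pos(1) \<open>\<nu> u = 0\<close> by force
    then show "\<exists>\<alpha>. u = \<alpha> *\<^sub>R 1"
      using pos(2) w(2) order_stat_const_iff by blast
  next
    assume "\<exists>\<alpha>. u = \<alpha> *\<^sub>R 1"
    then obtain \<alpha> where u: "u = \<alpha> *\<^sub>R 1" ..
    obtain w p where wp: "w \<in> W" "\<nu> u = w \<bullet> (\<chi> i. u $ p i)"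
      using attained by blast
    have "(\<chi> i. u $ p i) = \<alpha> *\<^sub>R 1" by (simp add: u vec_eq_iff)
    then show "\<nu> u = 0" using wp asc(2)[OF wp(1)] by (simp add: inner_commute)
  qed
  \<comment> \<open>Continuity comes from convexity in finite dimension; \<open>1 - _\<close> fits
    the order of the weights in \<open>convex_onI\<close>.\<close>
  have "convex_on UNIV \<nu>"
    by (rule convex_onI) (use convex[of "1 - _"] in \<open>simp_all\<close>)
  then have "continuous_on UNIV \<nu>" by (rule convex_on_continuous[OF open_UNIV])
  moreover have "\<nu> (P *v u) = \<nu> u" if P: "permutation_matrix P" for P u
  proof -
    obtain p where p: "p permutes UNIV" "P = (\<chi> i j. if j = p i then 1 else 0)"
      using P by (auto simp: permutation_matrix_def)
    have "\<nu> u \<le> \<nu> (\<chi> i. u $ p i)"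
      using permute_le[OF permutes_inv[OF p(1)], of "\<chi> i. u $ p i"] p(1)
      by (simp add: permutes_inverses)
    then show ?thesis
      using permute_le[OF p(1), of u] by (simp add: p(2) permutation_matrix_vector_mult)
  qed
  moreover have "\<nu> (u + \<alpha> *\<^sub>R 1) = \<nu> u" for u \<alpha>
    using translation_le[of u \<alpha>] translation_le[of "u + \<alpha> *\<^sub>R 1" "- \<alpha>"] by simp
  moreover have "\<nu> (\<alpha> *\<^sub>R u) = \<alpha> * \<nu> u" if "\<alpha> > 0" for u \<alpha>
    using scale_le[OF that, of u] scale_le[of "1 / \<alpha>" "\<alpha> *\<^sub>R u"] that by (simp add: field_simps)
  ultimately show ?thesis
    unfolding convex_fairness_measure_def using nonneg zero_iff convex by blast
qed

section \<open>From a fairness measure to its set of weights\<close>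

lemma convex_fairness_measure_imp_SUP:
  fixes \<nu> :: "real ^ 'n::{finite,linorder} \<Rightarrow> real"
  assumes card: "CARD('n) \<ge> 2" and cfm: "convex_fairness_measure \<nu>"
  shows "\<exists>W. W \<noteq> {} \<and> convex W \<and> compact W \<and> W \<subseteq> ascending_zero_sum \<and> W \<noteq> {0} \<and>
    (\<forall>u. \<nu> u = (SUP w\<in>W. weighted_order_sum w u))"
proof -
  note cfm = cfm[unfolded convex_fairness_measure_def]
  have hom: "\<nu> (t *\<^sub>R u) = t * \<nu> u" if "t > 0" for t u using cfm that by blast
  have perm: "\<nu> (\<chi> i. u $ p i) = \<nu> u" if "p permutes UNIV" for u p
  proof -
    have "permutation_matrix (\<chi> i j. if j = p i then 1 else 0)"
      using that by (auto simp: permutation_matrix_def)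
    then have "\<nu> ((\<chi> i j. if j = p i then 1 else 0) *v u) = \<nu> u" using cfm by blast
    then show ?thesis by (simp only: permutation_matrix_vector_mult)
  qed
  have conv: "convex_on UNIV \<nu>"
  proof (rule convex_onI)
    fix t :: real and u v assume "0 < t" "t < 1"
    moreover have "\<forall>u v \<alpha>. 0 < \<alpha> \<and> \<alpha> < 1 \<longrightarrow>
        \<nu> (\<alpha> *\<^sub>R u + (1 - \<alpha>) *\<^sub>R v) \<le> \<alpha> * \<nu> u + (1 - \<alpha>) * \<nu> v"
      using cfm by blast
    ultimately show "\<nu> ((1 - t) *\<^sub>R u + t *\<^sub>R v) \<le> (1 - t) * \<nu> u + t * \<nu> v"
      by (metis add.commute)
  qed simp
  define D where "D = {w. \<forall>u. w \<bullet> u \<le> \<nu> u}"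
  define W where "W = D \<inter> ascending_vectors"
  \<comment> \<open>Permuting a form by \<open>p\<close> amounts to permuting its argument by
    \<open>inv p\<close>, which leaves \<open>\<nu>\<close> unchanged.\<close>
  have D_permuted: "(\<chi> i. w $ p i) \<in> D" if w: "w \<in> D" and p: "p permutes UNIV" for w p
  proof -
    have "(\<chi> i. w $ p i) \<bullet> u \<le> \<nu> u" for u
    proof -
      have "(\<chi> i. w $ p i) \<bullet> u = w \<bullet> (\<chi> i. u $ inv p i)"
        using inner_permuted_inv[OF permutes_inv[OF p], of w u] p
        by (simp add: permutes_inv_inv)
      also have "\<dots> \<le> \<nu> (\<chi> i. u $ inv p i)" using w by (simp add: D_def)
      finally show ?thesis using perm[OF permutes_inv[OF p]] by simp
    qed
    then show ?thesis by (simp add: D_def)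
  qed
  have le: "weighted_order_sum w u \<le> \<nu> u" if "w \<in> W" for w u
  proof -
    \<comment> \<open>The minorant is evaluated at the sorted vector, where symmetry gives
      \<open>\<nu>\<close> the same value as at \<open>u\<close>.\<close>
    have "weighted_order_sum w u \<le> \<nu> (order_stat u)"
      using that by (simp add: W_def D_def weighted_order_sum_inner)
    then show ?thesis using order_stat_permutation[of u] perm by metis
  qed
  have attained: "\<exists>w\<in>W. weighted_order_sum w u = \<nu> u" for u
  proof -
    obtain w where w: "\<And>v. w \<bullet> v \<le> \<nu> v" "w \<bullet> u = \<nu> u"
      using sublinear_linear_minorant[OF conv hom] by blast
    then have "w \<in> D" by (simp add: D_def)
    \<comment> \<open>Sorting the form that touches \<open>\<nu>\<close> at \<open>u\<close> keeps
      it in \<open>D\<close> and can only raise its value, so equality persists.\<close>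
    then have "order_stat w \<in> W"
      using order_stat_permutation[of w] D_permuted order_stat_ascending
      unfolding W_def by (metis IntI)
    moreover have "\<nu> u \<le> weighted_order_sum (order_stat w) u"
      using inner_le_order_stat[of w u] w(2) by (simp add: weighted_order_sum_inner)
    ultimately show ?thesis using le by (metis order_antisym)
  qed
  have "W \<noteq> {}" using attained by blast
  moreover have "convex W"
    unfolding W_def D_def by (intro convex_Int convex_linear_minorants convex_ascending_vectors)
  moreover have "compact W"
    unfolding W_def D_def
    by (intro compact_Int_closed compact_linear_minorants closed_ascending_vectors)
  moreover have "W \<subseteq> ascending_zero_sum"
  proof
    fix w assume w: "w \<in> W"
    \<comment> \<open>As \<open>\<nu>\<close> vanishes on the constants, a minorant is nonpositive
      at both \<open>1\<close> and \<open>- 1\<close>, hence zero there.\<close>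
    have \<nu>1: "\<nu> (\<alpha> *\<^sub>R 1) = 0" for \<alpha> using cfm by blast
    have "w \<bullet> (\<alpha> *\<^sub>R 1) \<le> 0" for \<alpha>
      using w unfolding W_def D_def by (metis (mono_tags) IntD1 \<nu>1 mem_Collect_eq)
    from this[of 1] this[of "- 1"] have "1 \<bullet> w = 0" by (simp add: inner_commute)
    then show "w \<in> ascending_zero_sum" using w by (simp add: W_def ascending_zero_sum_def)
  qed
  moreover have "\<forall>u. \<nu> u = (SUP w\<in>W. weighted_order_sum w u)"
  proof
    fix u
    have "(SUP w\<in>W. weighted_order_sum w u) = \<nu> u"
      using attained[of u] le by (intro cSup_eq_maximum) force+
    then show "\<nu> u = (SUP w\<in>W. weighted_order_sum w u)" ..
  qed
  moreover have "W \<noteq> {0}"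
  proof
    \<comment> \<open>Then \<open>\<nu>\<close> would vanish identically and every vector would be
      constant, but with two distinct indices an axis vector is not.\<close>
    assume "W = {0}"
    then have "\<nu> u = 0" for u
      using attained[of u] by (simp add: weighted_order_sum_inner)
    moreover have "\<nu> u = 0 \<longleftrightarrow> (\<exists>\<alpha>. u = \<alpha> *\<^sub>R 1)" for u using cfm by blast
    ultimately have const: "\<exists>\<alpha>. u = \<alpha> *\<^sub>R 1" for u :: "real ^ 'n::{finite,linorder}" by blast
    have "\<not> CARD('n) \<le> Suc 0" using card by simp
    then obtain i j :: 'n where "i \<noteq> j"
      using card_le_Suc0_iff_eq[of "UNIV :: 'n set"] by auto
    then have "axis i (1::real) $ i \<noteq> axis i 1 $ j" by (simp add: axis_def)
    moreover obtain \<alpha> where "axis i (1::real) = \<alpha> *\<^sub>R 1" using const by blast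
    ultimately show False by simp
  qed
  ultimately show ?thesis by blast
qed

theorem theorem3:
  fixes \<nu> :: "real ^ 'n::{finite,linorder} \<Rightarrow> real"
  assumes "CARD('n) \<ge> 2"
  shows
    "(convex_fairness_measure \<nu> \<longleftrightarrow>
       (\<exists>W. W \<noteq> {} \<and> convex W \<and> compact W \<and> W \<subseteq> ascending_zero_sum \<and> W \<noteq> {0} \<and>
            (\<forall>u. \<nu> u = (SUP w\<in>W. weighted_order_sum w u)))) \<and>
     (convex_fairness_measure \<nu> \<longleftrightarrow>
       (\<exists>W. W \<noteq> {} \<and> compact W \<and> W \<subseteq> ascending_zero_sum \<and> W \<noteq> {0} \<and>
            (\<forall>u. \<nu> u = (SUP w\<in>W. weighted_order_sum w u))))"
proof -
  have "convex_fairness_measure \<nu>"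
    if "\<exists>W. W \<noteq> {} \<and> compact W \<and> W \<subseteq> ascending_zero_sum \<and> W \<noteq> {0} \<and>
      (\<forall>u. \<nu> u = (SUP w\<in>W. weighted_order_sum w u))"
    using that convex_fairness_measure_SUP by blast
  then show ?thesis
    using convex_fairness_measure_imp_SUP[OF assms, of \<nu>] by blast
qed

end
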